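(* Let $0\to(V,[~,~]_V=0,S)\xrightarrow{i}(\mathfrak{e},[~,~]_\mathfrak{e},U)\xrightarrow{p}(\mathfrak{g},[~,~]_\mathfrak{g},N)\to0$ be an abelian extension of the Nijenhuis Lie algebra $(\mathfrak{g},[~,~]_\mathfrak{g},N)$ by the Nijenhuis representation $(V,\rho,S)$. Then there is an exact sequence $$0\to\mathrm{Der}((\mathfrak{g},N);(V,S))\xrightarrow{\iota}\mathrm{Der}_V(\mathfrak{e},U)\xrightarrow{\eta}\mathcal{D}_\rho\xrightarrow{\mathcal{W}}H^2((\mathfrak{g},N);(V,S)),$$ where $\iota$ is given by $\iota(d)(e)=d(p(e))$, for $d\in\mathrm{Der}((\mathfrak{g},N);(V,S))$ and $e\in\mathfrak{e}$.
   Context: All vector spaces are over a fixed field. A Nijenhuis operator on a Lie algebra $(\mathfrak{g},[~,~]_\mathfrak{g})$ is a linear map $N:\mathfrak{g}\to\mathfrak{g}$ with $[N(x),N(y)]_\mathfrak{g}=N([N(x),y]_\mathfrak{g}+[x,N(y)]_\mathfrak{g}-N[x,y]_\mathfrak{g})$ for all $x,y\in\mathfrak{g}$. A Nijenhuis Lie algebra is a Lie algebra with a Nijenhuis operator; homomorphisms are Lie algebra homomorphisms commuting with the Nijenhuis operators. A Nijenhuis representation of $(\mathfrak{g},[~,~]_\mathfrak{g},N)$ is a triple $(V,\rho,S)$ with $(V,\rho)$ a representation of the Lie algebra $\mathfrak{g}$ and $S:V\to V$ linear with $\rho_{N(x)}S(v)=S(\rho_{N(x)}v+\rho_xS(v)-S(\rho_xv))$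 for all $x\in\mathfrak{g}$, $v\in V$. $\mathrm{Der}(\mathfrak{g},N)$ is the space of Nijenhuis Lie algebra derivations: Lie algebra derivations $D$ of $\mathfrak{g}$ with $N\circ D=D\circ N$. $(V,S)$ is regarded as a Nijenhuis Lie algebra with zero bracket, so $\mathrm{Der}(V,S)$ is the space of linear endomorphisms of $V$ commuting with $S$. $\mathrm{Der}((\mathfrak{g},N);(V,S))$ is the space of linear maps $d:\mathfrak{g}\to V$ with $S\circ d=d\circ N$ and $d([x,y]_\mathfrak{g})=\rho_xd(y)-\rho_yd(x)$ for all $x,y\in\mathfrak{g}$. An abelian extension of $(\mathfrak{g},N)$ by the Nijenhuis representation $(V,\rho,S)$ is a short exact sequence of Nijenhuis Lie algebras $0\to(V,0,S)\xrightarrow{i}(\mathfrak{e},[~,~]_\mathfrak{e},U)\xrightarrow{p}(\mathfrak{g},[~,~]_\mathfrak{g},N)\to0$, with $V$ identified with $i(V)\subset\mathfrak{e}$, such that $\rho_xv=[s(x),v]_\mathfrak{e}$ for any section $s$ of $p$ (a linear map $s:\mathfrak{g}\to\mathfrak{e}$ with $ps=\mathrm{Id}_\mathfrak{g}$; this is independent of $s$). $\mathrm{Der}_V(\mathfrak{e},U)=\{D\in\mathrm{Der}(\mathfrak{e},U)\mid D(V)\subset V\}$, and $\eta(D)=(D|_V,\overline{D})$ with $\overline{D}=pDs$ (independent of the section $s$). $\mathcal{D}_\rho=\{(D_V,D_\mathfrak{g})\in\mathrm{Der}(V,S)\times\mathrm{Der}(\mathfrak{g},N)\mid D_V(\rho_xv)=\rho_{D_\mathfrak{g}(x)}v+\rho_xD_V(v)\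 \forall x\in\mathfrak{g},v\in V\}$; the image of $\eta$ lies in $\mathcal{D}_\rho$. A 2-cocycle of $(\mathfrak{g},N)$ with coefficients in $(V,\rho,S)$ is a pair $(\chi,F)$ of linear maps $\chi:\wedge^2\mathfrak{g}\to V$, $F:\mathfrak{g}\to V$ such that for all $x,y,z\in\mathfrak{g}$: (1) $\rho_x\chi(y,z)+\rho_y\chi(z,x)+\rho_z\chi(x,y)-\chi([x,y]_\mathfrak{g},z)-\chi([y,z]_\mathfrak{g},x)-\chi([z,x]_\mathfrak{g},y)=0$; (2) $\chi(N(x),N(y))-S(\chi(N(x),y)+\chi(x,N(y))-S(\chi(x,y)))-F([N(x),y]_\mathfrak{g}+[x,N(y)]_\mathfrak{g}-N[x,y]_\mathfrak{g})+\rho_{N(x)}F(y)-\rho_{N(y)}F(x)-S(\rho_xF(y)-\rho_yF(x)-F[x,y]_\mathfrak{g})=0$. $(\chi,F)$, $(\chi',F')$ are cohomologous if there is a linear map $\varphi:\mathfrak{g}\to V$ with $\chi(x,y)-\chi'(x,y)=\rho_x\varphi(y)-\rho_y\varphi(x)-\varphi([x,y]_\mathfrak{g})$ and $F(x)-F'(x)=S(\varphi(x))-\varphi(N(x))$. $H^2((\mathfrak{g},N);(V,S))$ is the space of 2-cocycles modulo this relation. A section $s$ of the extension produces the 2-cocycle $\chi(x,y)=[s(x),s(y)]_\mathfrak{e}-s[x,y]_\mathfrak{g}$, $F(x)=(Us-sN)(x)$. Wells map: $\mathcal{W}:\mathcal{D}_\rho\to H^2((\mathfrak{g},N);(V,S))$,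 $\mathcal{W}(D_V,D_\mathfrak{g})=[(\chi_{(D_V,D_\mathfrak{g})},F_{(D_V,D_\mathfrak{g})})]$, where $(\chi,F)$ is the 2-cocycle produced by a section $s$ and $\chi_{(D_V,D_\mathfrak{g})}(x,y)=D_V(\chi(x,y))-\chi(D_\mathfrak{g}(x),y)-\chi(x,D_\mathfrak{g}(y))$, $F_{(D_V,D_\mathfrak{g})}(x)=D_V(F(x))-F(D_\mathfrak{g}(x))$; this pair is a 2-cocycle and its class is independent of $s$. *)

theory Defs
  imports Complex_Main "HOL-Library.Function_Algebras" "HOL-Library.Product_Plus"
begin

text \<open>
  The spaces \<open>V\<close>, \<open>\<gg>\<close>, \<open>\<ee>\<close> are whole types of class \<open>ab_group_add\<close>, each with a scalar
  multiplication over one field \<open>'k\<close> satisfying the locale \<open>vector_space\<close>. The terms of the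
  Wells sequence are subsets of function types, or sets of cosets, so they are recorded as
  vector spaces with an explicit carrier.
\<close>

record ('k, 'a) vspace =
  carr :: "'a set"
  zer :: 'a
  vadd :: "'a \<Rightarrow> 'a \<Rightarrow> 'a"
  smul :: "'k \<Rightarrow> 'a \<Rightarrow> 'a"

definition is_vspace :: "('k::field, 'a) vspace \<Rightarrow> bool" where
  "is_vspace X \<longleftrightarrow>
     zer X \<in> carr X \<and>
     (\<forall>a\<in>carr X. \<forall>b\<in>carr X. vadd X a b \<in> carr X) \<and>
     (\<forall>c. \<forall>a\<in>carr X. smul X c a \<in> carr X) \<and>
     (\<forall>a\<in>carr X. \<forall>b\<in>carr X. \<forall>c\<in>carr X. vadd X (vadd X a b) c = vadd X a (vadd X b c)) \<and>
     (\<forall>a\<in>carr X. \<forall>b\<in>carr X. vadd X a b = vadd X b a) \<and>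
     (\<forall>a\<in>carr X. vadd X (zer X) a = a) \<and>
     (\<forall>a\<in>carr X. \<exists>b\<in>carr X. vadd X a b = zer X) \<and>
     (\<forall>c. \<forall>a\<in>carr X. \<forall>b\<in>carr X. smul X c (vadd X a b) = vadd X (smul X c a) (smul X c b)) \<and>
     (\<forall>c d. \<forall>a\<in>carr X. smul X (c + d) a = vadd X (smul X c a) (smul X d a)) \<and>
     (\<forall>c d. \<forall>a\<in>carr X. smul X (c * d) a = smul X c (smul X d a)) \<and>
     (\<forall>a\<in>carr X. smul X 1 a = a)"

definition linear_map ::
  "('k::field, 'a) vspace \<Rightarrow> ('k, 'b) vspace \<Rightarrow> ('a \<Rightarrow> 'b) \<Rightarrow> bool" where
  "linear_map X Y f \<longleftrightarrow>
     is_vspace X \<and> is_vspace Y \<and>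
     (\<forall>a\<in>carr X. f a \<in> carr Y) \<and>
     (\<forall>a\<in>carr X. \<forall>b\<in>carr X. f (vadd X a b) = vadd Y (f a) (f b)) \<and>
     (\<forall>c. \<forall>a\<in>carr X. f (smul X c a) = smul Y c (f a))"

definition vker :: "('k, 'a) vspace \<Rightarrow> ('k, 'b) vspace \<Rightarrow> ('a \<Rightarrow> 'b) \<Rightarrow> 'a set" where
  "vker X Y f = {a \<in> carr X. f a = zer Y}"

text \<open>Exactness of \<open>0 \<rightarrow> A \<rightarrow> B \<rightarrow> C \<rightarrow> D\<close> (there is no condition at \<open>D\<close>).\<close>

definition exact_sequence ::
  "('k::field, 'a) vspace \<Rightarrow> ('k, 'b) vspace \<Rightarrow> ('k, 'c) vspace \<Rightarrow> ('k, 'd) vspace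
    \<Rightarrow> ('a \<Rightarrow> 'b) \<Rightarrow> ('b \<Rightarrow> 'c) \<Rightarrow> ('c \<Rightarrow> 'd) \<Rightarrow> bool" where
  "exact_sequence A B C D f g h \<longleftrightarrow>
     linear_map A B f \<and> linear_map B C g \<and> linear_map C D h \<and>
     vker A B f = {zer A} \<and>
     vker B C g = f ` carr A \<and>
     vker C D h = g ` carr B"

definition fun_scale :: "('k \<Rightarrow> 'b \<Rightarrow> 'b) \<Rightarrow> 'k \<Rightarrow> ('a \<Rightarrow> 'b) \<Rightarrow> 'a \<Rightarrow> 'b" where
  "fun_scale s c f = (\<lambda>x. s c (f x))"

definition prod_scale ::
  "('k \<Rightarrow> 'a \<Rightarrow> 'a) \<Rightarrow> ('k \<Rightarrow> 'b \<Rightarrow> 'b) \<Rightarrow> 'k \<Rightarrow> 'a \<times> 'b \<Rightarrow> 'a \<times> 'b" where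
  "prod_scale s t c z = (s c (fst z), t c (snd z))"

definition subspace_of :: "('k \<Rightarrow> 'a \<Rightarrow> 'a) \<Rightarrow> 'a set \<Rightarrow> ('k, 'a::ab_group_add) vspace" where
  "subspace_of s W = \<lparr>carr = W, zer = 0, vadd = (+), smul = s\<rparr>"

definition bilinear_map ::
  "('k::field \<Rightarrow> 'a::ab_group_add \<Rightarrow> 'a) \<Rightarrow> ('k \<Rightarrow> 'b::ab_group_add \<Rightarrow> 'b)
    \<Rightarrow> ('k \<Rightarrow> 'c::ab_group_add \<Rightarrow> 'c) \<Rightarrow> ('a \<Rightarrow> 'b \<Rightarrow> 'c) \<Rightarrow> bool" where
  "bilinear_map sa sb sc f \<longleftrightarrow>
     (\<forall>y. Vector_Spaces.linear sa sc (\<lambda>x. f x y)) \<and>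
     (\<forall>x. Vector_Spaces.linear sb sc (\<lambda>y. f x y))"

locale lie_algebra = vector_space scale
  for scale :: "'k::field \<Rightarrow> 'g::ab_group_add \<Rightarrow> 'g" +
  fixes br :: "'g \<Rightarrow> 'g \<Rightarrow> 'g"
  assumes bilinear: "bilinear_map scale scale scale br"
    and alternating: "br x x = 0"
    and jacobi: "br x (br y z) + br y (br z x) + br z (br x y) = 0"

locale nijenhuis_lie_algebra = lie_algebra scale br
  for scale :: "'k::field \<Rightarrow> 'g::ab_group_add \<Rightarrow> 'g" and br :: "'g \<Rightarrow> 'g \<Rightarrow> 'g" +
  fixes N :: "'g \<Rightarrow> 'g"
  assumes linear_N: "Vector_Spaces.linear scale scale N"
    and nijenhuis: "br (N x) (N y) = N (br (N x) y + br x (N y) - N (br x y))"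

definition nijenhuis_hom ::
  "('k::field \<Rightarrow> 'a::ab_group_add \<Rightarrow> 'a) \<Rightarrow> ('a \<Rightarrow> 'a \<Rightarrow> 'a) \<Rightarrow> ('a \<Rightarrow> 'a)
    \<Rightarrow> ('k \<Rightarrow> 'b::ab_group_add \<Rightarrow> 'b) \<Rightarrow> ('b \<Rightarrow> 'b \<Rightarrow> 'b) \<Rightarrow> ('b \<Rightarrow> 'b)
    \<Rightarrow> ('a \<Rightarrow> 'b) \<Rightarrow> bool" where
  "nijenhuis_hom sa bra M sb brb N f \<longleftrightarrow>
     Vector_Spaces.linear sa sb f \<and>
     (\<forall>x y. f (bra x y) = brb (f x) (f y)) \<and>
     f \<circ> M = N \<circ> f"

locale nijenhuis_representation =
  nijenhuis_lie_algebra sG br N + V: vector_space sV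
  for sG :: "'k::field \<Rightarrow> 'g::ab_group_add \<Rightarrow> 'g" and br :: "'g \<Rightarrow> 'g \<Rightarrow> 'g"
    and N :: "'g \<Rightarrow> 'g" and sV :: "'k \<Rightarrow> 'v::ab_group_add \<Rightarrow> 'v" +
  fixes \<rho> :: "'g \<Rightarrow> 'v \<Rightarrow> 'v" and S :: "'v \<Rightarrow> 'v"
  assumes bilinear_rho: "bilinear_map sG sV sV \<rho>"
    and rho_br: "\<rho> (br x y) v = \<rho> x (\<rho> y v) - \<rho> y (\<rho> x v)"
    and linear_S: "Vector_Spaces.linear sV sV S"
    and nijenhuis_rho: "\<rho> (N x) (S v) = S (\<rho> (N x) v + \<rho> x (S v) - S (\<rho> x v))"

abbreviation zero_br :: "'v \<Rightarrow> 'v \<Rightarrow> 'v::zero" where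
  "zero_br \<equiv> \<lambda>_ _. 0"

definition linear_section ::
  "('k::field \<Rightarrow> 'g::ab_group_add \<Rightarrow> 'g) \<Rightarrow> ('k \<Rightarrow> 'e::ab_group_add \<Rightarrow> 'e)
    \<Rightarrow> ('e \<Rightarrow> 'g) \<Rightarrow> ('g \<Rightarrow> 'e) \<Rightarrow> bool" where
  "linear_section sG sE p s \<longleftrightarrow> Vector_Spaces.linear sG sE s \<and> p \<circ> s = id"

text \<open>
  The embedding \<open>i\<close> of \<open>V\<close> into \<open>\<ee>\<close> is kept explicit throughout, so that the subspace \<open>V\<close>
  of \<open>\<ee>\<close> is \<open>range i\<close>.
\<close>

locale abelian_extension =
  nijenhuis_representation sG brG N sV \<rho> S + E: nijenhuis_lie_algebra sE brE U
  for sG :: "'k::field \<Rightarrow> 'g::ab_group_add \<Rightarrow> 'g" and brG :: "'g \<Rightarrow> 'g \<Rightarrow> 'g"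
    and N :: "'g \<Rightarrow> 'g"
    and sV :: "'k \<Rightarrow> 'v::ab_group_add \<Rightarrow> 'v" and \<rho> :: "'g \<Rightarrow> 'v \<Rightarrow> 'v" and S :: "'v \<Rightarrow> 'v"
    and sE :: "'k \<Rightarrow> 'e::ab_group_add \<Rightarrow> 'e" and brE :: "'e \<Rightarrow> 'e \<Rightarrow> 'e"
    and U :: "'e \<Rightarrow> 'e" +
  fixes i :: "'v \<Rightarrow> 'e" and p :: "'e \<Rightarrow> 'g"
  assumes hom_i: "nijenhuis_hom sV zero_br S sE brE U i"
    and hom_p: "nijenhuis_hom sE brE U sG brG N p"
    and inj_i: "inj i"
    and exact_middle: "range i = {e. p e = 0}"
    and surj_p: "surj p"
    and action: "linear_section sG sE p s \<Longrightarrow> i (\<rho> x v) = brE (s x) (i v)"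

definition der ::
  "('k::field \<Rightarrow> 'a::ab_group_add \<Rightarrow> 'a) \<Rightarrow> ('a \<Rightarrow> 'a \<Rightarrow> 'a) \<Rightarrow> ('a \<Rightarrow> 'a) \<Rightarrow> ('a \<Rightarrow> 'a) set" where
  "der s br N =
     {D. Vector_Spaces.linear s s D \<and>
         (\<forall>x y. D (br x y) = br (D x) y + br x (D y)) \<and> N \<circ> D = D \<circ> N}"

definition der_coeff ::
  "('k::field \<Rightarrow> 'g::ab_group_add \<Rightarrow> 'g) \<Rightarrow> ('g \<Rightarrow> 'g \<Rightarrow> 'g) \<Rightarrow> ('g \<Rightarrow> 'g)
    \<Rightarrow> ('k \<Rightarrow> 'v::ab_group_add \<Rightarrow> 'v) \<Rightarrow> ('g \<Rightarrow> 'v \<Rightarrow> 'v) \<Rightarrow> ('v \<Rightarrow> 'v) \<Rightarrow> ('g \<Rightarrow> 'v) set" where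
  "der_coeff sG br N sV \<rho> S =
     {d. Vector_Spaces.linear sG sV d \<and> S \<circ> d = d \<circ> N \<and>
         (\<forall>x y. d (br x y) = \<rho> x (d y) - \<rho> y (d x))}"

definition der_preserving ::
  "('k::field \<Rightarrow> 'e::ab_group_add \<Rightarrow> 'e) \<Rightarrow> ('e \<Rightarrow> 'e \<Rightarrow> 'e) \<Rightarrow> ('e \<Rightarrow> 'e) \<Rightarrow> ('v \<Rightarrow> 'e)
    \<Rightarrow> ('e \<Rightarrow> 'e) set" where
  "der_preserving sE br U i = {D \<in> der sE br U. D ` range i \<subseteq> range i}"

definition compatible_der ::
  "('k::field \<Rightarrow> 'g::ab_group_add \<Rightarrow> 'g) \<Rightarrow> ('g \<Rightarrow> 'g \<Rightarrow> 'g) \<Rightarrow> ('g \<Rightarrow> 'g)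
    \<Rightarrow> ('k \<Rightarrow> 'v::ab_group_add \<Rightarrow> 'v) \<Rightarrow> ('g \<Rightarrow> 'v \<Rightarrow> 'v) \<Rightarrow> ('v \<Rightarrow> 'v)
    \<Rightarrow> (('v \<Rightarrow> 'v) \<times> ('g \<Rightarrow> 'g)) set" where
  "compatible_der sG br N sV \<rho> S =
     {(DV, DG). DV \<in> der sV zero_br S \<and> DG \<in> der sG br N \<and>
        (\<forall>x v. DV (\<rho> x v) = \<rho> (DG x) v + \<rho> x (DV v))}"

text \<open>A linear map on \<open>\<and>\<^sup>2\<gg>\<close> is given as an alternating bilinear map.\<close>

definition cocycles ::
  "('k::field \<Rightarrow> 'g::ab_group_add \<Rightarrow> 'g) \<Rightarrow> ('g \<Rightarrow> 'g \<Rightarrow> 'g) \<Rightarrow> ('g \<Rightarrow> 'g)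
    \<Rightarrow> ('k \<Rightarrow> 'v::ab_group_add \<Rightarrow> 'v) \<Rightarrow> ('g \<Rightarrow> 'v \<Rightarrow> 'v) \<Rightarrow> ('v \<Rightarrow> 'v)
    \<Rightarrow> (('g \<Rightarrow> 'g \<Rightarrow> 'v) \<times> ('g \<Rightarrow> 'v)) set" where
  "cocycles sG br N sV \<rho> S =
     {(\<chi>, F). bilinear_map sG sG sV \<chi> \<and> (\<forall>x. \<chi> x x = 0) \<and> Vector_Spaces.linear sG sV F \<and>
        (\<forall>x y z. \<rho> x (\<chi> y z) + \<rho> y (\<chi> z x) + \<rho> z (\<chi> x y)
                 - \<chi> (br x y) z - \<chi> (br y z) x - \<chi> (br z x) y = 0) \<and>
        (\<forall>x y. \<chi> (N x) (N y) - S (\<chi> (N x) y + \<chi> x (N y) - S (\<chi> x y))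
               - F (br (N x) y + br x (N y) - N (br x y))
               + \<rho> (N x) (F y) - \<rho> (N y) (F x)
               - S (\<rho> x (F y) - \<rho> y (F x) - F (br x y)) = 0)}"

definition cohomologous ::
  "('k::field \<Rightarrow> 'g::ab_group_add \<Rightarrow> 'g) \<Rightarrow> ('g \<Rightarrow> 'g \<Rightarrow> 'g) \<Rightarrow> ('g \<Rightarrow> 'g)
    \<Rightarrow> ('k \<Rightarrow> 'v::ab_group_add \<Rightarrow> 'v) \<Rightarrow> ('g \<Rightarrow> 'v \<Rightarrow> 'v) \<Rightarrow> ('v \<Rightarrow> 'v)
    \<Rightarrow> (('g \<Rightarrow> 'g \<Rightarrow> 'v) \<times> ('g \<Rightarrow> 'v)) rel" where
  "cohomologous sG br N sV \<rho> S =
     {((\<chi>, F), (\<chi>', F')).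
        (\<chi>, F) \<in> cocycles sG br N sV \<rho> S \<and> (\<chi>', F') \<in> cocycles sG br N sV \<rho> S \<and>
        (\<exists>\<phi>. Vector_Spaces.linear sG sV \<phi> \<and>
             (\<forall>x y. \<chi> x y - \<chi>' x y = \<rho> x (\<phi> y) - \<rho> y (\<phi> x) - \<phi> (br x y)) \<and>
             (\<forall>x. F x - F' x = S (\<phi> x) - \<phi> (N x)))}"

abbreviation cochain_scale ::
  "('k \<Rightarrow> 'v \<Rightarrow> 'v) \<Rightarrow> 'k \<Rightarrow> ('g \<Rightarrow> 'g \<Rightarrow> 'v) \<times> ('g \<Rightarrow> 'v) \<Rightarrow> ('g \<Rightarrow> 'g \<Rightarrow> 'v) \<times> ('g \<Rightarrow> 'v)" where
  "cochain_scale s \<equiv> prod_scale (fun_scale (fun_scale s)) (fun_scale s)"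

text \<open>
  The operations on classes are induced from representatives. A class scaled by \<open>c\<close> must be
  closed up under the relation again: the pointwise image of a class under scaling by \<open>0\<close> is
  a singleton, not a class.
\<close>

definition H2 ::
  "('k::field \<Rightarrow> 'g::ab_group_add \<Rightarrow> 'g) \<Rightarrow> ('g \<Rightarrow> 'g \<Rightarrow> 'g) \<Rightarrow> ('g \<Rightarrow> 'g)
    \<Rightarrow> ('k \<Rightarrow> 'v::ab_group_add \<Rightarrow> 'v) \<Rightarrow> ('g \<Rightarrow> 'v \<Rightarrow> 'v) \<Rightarrow> ('v \<Rightarrow> 'v)
    \<Rightarrow> ('k, (('g \<Rightarrow> 'g \<Rightarrow> 'v) \<times> ('g \<Rightarrow> 'v)) set) vspace" where
  "H2 sG br N sV \<rho> S =
     (let R = cohomologous sG br N sV \<rho> S in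
      \<lparr>carr = cocycles sG br N sV \<rho> S // R,
       zer = R `` {0},
       vadd = (\<lambda>A B. \<Union>a\<in>A. \<Union>b\<in>B. R `` {a + b}),
       smul = (\<lambda>c A. \<Union>a\<in>A. R `` {cochain_scale sV c a})\<rparr>)"

definition iota :: "('v \<Rightarrow> 'e) \<Rightarrow> ('e \<Rightarrow> 'g) \<Rightarrow> ('g \<Rightarrow> 'v) \<Rightarrow> 'e \<Rightarrow> 'e" where
  "iota i p d = (\<lambda>e. i (d (p e)))"

text \<open>The restriction of \<open>D\<close> to \<open>V = range i\<close>, read as an endomorphism of \<open>V\<close>, is \<open>inv i \<circ> D \<circ> i\<close>.\<close>

definition eta ::
  "('v \<Rightarrow> 'e) \<Rightarrow> ('e \<Rightarrow> 'g) \<Rightarrow> ('g \<Rightarrow> 'e) \<Rightarrow> ('e \<Rightarrow> 'e) \<Rightarrow> ('v \<Rightarrow> 'v) \<times> ('g \<Rightarrow> 'g)" where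
  "eta i p s D = (inv i \<circ> D \<circ> i, p \<circ> D \<circ> s)"

definition ext_chi ::
  "('g \<Rightarrow> 'g \<Rightarrow> 'g) \<Rightarrow> ('e \<Rightarrow> 'e \<Rightarrow> 'e) \<Rightarrow> ('v \<Rightarrow> 'e::minus) \<Rightarrow> ('g \<Rightarrow> 'e) \<Rightarrow> 'g \<Rightarrow> 'g \<Rightarrow> 'v" where
  "ext_chi brG brE i s x y = inv i (brE (s x) (s y) - s (brG x y))"

definition ext_F ::
  "('g \<Rightarrow> 'g) \<Rightarrow> ('e \<Rightarrow> 'e) \<Rightarrow> ('v \<Rightarrow> 'e::minus) \<Rightarrow> ('g \<Rightarrow> 'e) \<Rightarrow> 'g \<Rightarrow> 'v" where
  "ext_F N U i s x = inv i (U (s x) - s (N x))"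

definition twisted_pair ::
  "('g \<Rightarrow> 'g \<Rightarrow> 'v::ab_group_add) \<times> ('g \<Rightarrow> 'v) \<Rightarrow> ('v \<Rightarrow> 'v) \<times> ('g \<Rightarrow> 'g)
    \<Rightarrow> ('g \<Rightarrow> 'g \<Rightarrow> 'v) \<times> ('g \<Rightarrow> 'v)" where
  "twisted_pair = (\<lambda>(\<chi>, F) (DV, DG).
     (\<lambda>x y. DV (\<chi> x y) - \<chi> (DG x) y - \<chi> x (DG y), \<lambda>x. DV (F x) - F (DG x)))"

definition wells ::
  "('k::field \<Rightarrow> 'g::ab_group_add \<Rightarrow> 'g) \<Rightarrow> ('g \<Rightarrow> 'g \<Rightarrow> 'g) \<Rightarrow> ('g \<Rightarrow> 'g)
    \<Rightarrow> ('k \<Rightarrow> 'v::ab_group_add \<Rightarrow> 'v) \<Rightarrow> ('g \<Rightarrow> 'v \<Rightarrow> 'v) \<Rightarrow> ('v \<Rightarrow> 'v)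
    \<Rightarrow> ('e::minus \<Rightarrow> 'e \<Rightarrow> 'e) \<Rightarrow> ('e \<Rightarrow> 'e) \<Rightarrow> ('v \<Rightarrow> 'e) \<Rightarrow> ('g \<Rightarrow> 'e)
    \<Rightarrow> ('v \<Rightarrow> 'v) \<times> ('g \<Rightarrow> 'g) \<Rightarrow> (('g \<Rightarrow> 'g \<Rightarrow> 'v) \<times> ('g \<Rightarrow> 'v)) set" where
  "wells sG brG N sV \<rho> S brE U i s D =
     cohomologous sG brG N sV \<rho> S `` {twisted_pair (ext_chi brG brE i s, ext_F N U i s) D}"

end

theory Submission
  imports Defs
begin

text \<open>
  A linear section \<open>s\<close> identifies \<open>\<ee>\<close> with \<open>\<gg> \<oplus> V\<close>, and its cocycle \<open>(\<chi>, F)\<close> says by how much the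
  bracket and the operator differ from those of the semidirect product:
  \<open>[s x, s y] = s [x, y] + i (\<chi> (x, y))\<close> and \<open>U (s x) = s (N x) + i (F x)\<close>. A linear endomorphism \<open>D\<close>
  of \<open>\<ee>\<close> that preserves \<open>V\<close> is then a lower triangular matrix, that is, a triple \<open>(D\<^sub>V, D\<^sub>\<gg>, \<phi>)\<close> with
  \<open>D (s x + i v) = s (D\<^sub>\<gg> x) + i (\<phi> x + D\<^sub>V v)\<close>. Comparing the two components of the equations that make
  \<open>D\<close> a Nijenhuis derivation shows that \<open>D\<close> is one exactly if \<open>(D\<^sub>V, D\<^sub>\<gg>)\<close> is a compatible pair and the
  twisted cochain \<open>(D\<^sub>V \<chi> - \<chi> (D\<^sub>\<gg> -, -) - \<chi> (-, D\<^sub>\<gg> -), D\<^sub>V F - F D\<^sub>\<gg>)\<close> is the coboundary of \<open>\<phi>\<close>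
  (\<open>lift_in_der_preserving\<close> and \<open>eq_lift_of_eta\<close>).

  Exactness is read off from this description. The map \<open>\<eta>\<close> forgets \<open>\<phi>\<close>. Its kernel consists of the
  triples \<open>(0, 0, \<phi>)\<close>, for which the twisted cochain vanishes, so that \<open>\<phi>\<close> has coboundary zero; these
  are the derivations of \<open>\<gg>\<close> with values in \<open>V\<close>, embedded by \<open>\<iota>\<close>. Its image consists of the pairs for
  which some \<open>\<phi>\<close> exists, that is, for which the Wells class vanishes.

  The Wells map takes values in \<open>H\<^sup>2\<close> because the twisted cochain is again a cocycle
  (\<open>twisted_pair_cocycle\<close>): a compatible pair acts on all cochains by the Leibniz rule, and this action
  commutes with forming the two cocycle expressions. That \<open>H\<^sup>2\<close> is a vector space, and that a linear
  map into the cocycles induces one into \<open>H\<^sup>2\<close>, holds for the quotient of any subspace by any other.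
\<close>

section \<open>Linear and bilinear maps\<close>

lemma linear_laws:
  assumes "Vector_Spaces.linear sa sb f"
  shows "f (x + y) = f x + f y" "f (x - y) = f x - f y" "f (- x) = - f x" "f 0 = 0"
    "f (sa c x) = sb c (f x)"
proof -
  interpret Vector_Spaces.linear sa sb f by fact
  show "f (x + y) = f x + f y" "f (x - y) = f x - f y" "f (- x) = - f x" "f 0 = 0"
    "f (sa c x) = sb c (f x)"
    by (rule add diff neg zero scale)+
qed

lemma linearI:
  assumes "vector_space sa" "vector_space sb" "\<And>x y. f (x + y) = f x + f y"
    "\<And>c x. f (sa c x) = sb c (f x)"
  shows "Vector_Spaces.linear sa sb f"
  using assms by (simp add: Vector_Spaces.linear_iff)

lemma linear_domain: "Vector_Spaces.linear sa sb f \<Longrightarrow> vector_space sa"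
  and linear_codomain: "Vector_Spaces.linear sa sb f \<Longrightarrow> vector_space sb"
  by (simp_all add: Vector_Spaces.linear_iff)

lemma bilinear_laws:
  assumes "bilinear_map sa sb sc f"
  shows "f (x + x') y = f x y + f x' y" "f (x - x') y = f x y - f x' y" "f (- x) y = - f x y"
    "f 0 y = 0" "f (sa c x) y = sc c (f x y)"
    "f x (y + y') = f x y + f x y'" "f x (y - y') = f x y - f x y'" "f x (- y) = - f x y"
    "f x 0 = 0" "f x (sb c y) = sc c (f x y)"
proof -
  have l: "Vector_Spaces.linear sa sc (\<lambda>x. f x y)" for y
    using assms by (simp add: bilinear_map_def)
  have r: "Vector_Spaces.linear sb sc (f x)" for x
    using assms by (simp add: bilinear_map_def)
  show "f (x + x') y = f x y + f x' y" "f (x - x') y = f x y - f x' y" "f (- x) y = - f x y"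
    "f 0 y = 0" "f (sa c x) y = sc c (f x y)"
    by (rule linear_laws[OF l])+
  show "f x (y + y') = f x y + f x y'" "f x (y - y') = f x y - f x y'" "f x (- y) = - f x y"
    "f x 0 = 0" "f x (sb c y) = sc c (f x y)"
    by (rule linear_laws[OF r])+
qed

lemma bilinear_mapI:
  assumes "vector_space sa" "vector_space sb" "vector_space sc"
    "\<And>x x' y. f (x + x') y = f x y + f x' y" "\<And>c x y. f (sa c x) y = sc c (f x y)"
    "\<And>x y y'. f x (y + y') = f x y + f x y'" "\<And>c x y. f x (sb c y) = sc c (f x y)"
  shows "bilinear_map sa sb sc f"
  unfolding bilinear_map_def using assms by (auto intro!: linearI)

lemma alternating_imp_antisymmetric:
  assumes "bilinear_map sa sa sc f" "\<And>x. f x x = 0"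
  shows "f y x = - f x y"
proof -
  have "f (x + y) (x + y) = f x y + f y x"
    unfolding bilinear_laws[OF assms(1)] by (simp add: assms(2))
  then show ?thesis
    using assms(2)[of "x + y"] by (metis add.commute eq_neg_iff_add_eq_0)
qed

section \<open>Subspaces and quotients as vector spaces with a carrier\<close>

lemma subspace_carrierI:
  assumes "vector_space s" "0 \<in> W" "\<And>a b. a \<in> W \<Longrightarrow> b \<in> W \<Longrightarrow> a + b \<in> W"
    "\<And>c a. a \<in> W \<Longrightarrow> s c a \<in> W"
  shows "module.subspace s W"
proof -
  interpret vector_space s by fact
  show ?thesis using assms(2-4) by (rule subspaceI)
qed

lemma is_vspace_subspace_of:
  assumes "vector_space s" "module.subspace s W"
  shows "is_vspace (subspace_of s W)"
proof -
  interpret vector_space s by fact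
  have "\<exists>b\<in>W. a + b = 0" if "a \<in> W" for a
    using subspace_neg[OF assms(2) that] by (intro bexI[of _ "- a"]) auto
  then show ?thesis
    unfolding is_vspace_def subspace_of_def
    using subspace_0[OF assms(2)] subspace_add[OF assms(2)] subspace_scale[OF assms(2)]
    by (auto simp: add.assoc add.commute scale_right_distrib scale_left_distrib)
qed

lemma vector_space_fun_scale: "vector_space s \<Longrightarrow> vector_space (fun_scale s)"
  unfolding vector_space_def fun_scale_def by (auto simp: fun_eq_iff)

lemma vector_space_prod_scale:
  "vector_space s \<Longrightarrow> vector_space t \<Longrightarrow> vector_space (prod_scale s t)"
  unfolding vector_space_def prod_scale_def by (auto simp: prod_eq_iff)

text \<open>
  The relation whose classes are the cosets of \<open>Z \<inter> B\<close> in \<open>Z\<close>. It is the pattern of the relation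
  between cohomologous cocycles, which asks of both members that they be cocycles and of their
  difference that it be a coboundary.
\<close>

definition coset_rel :: "'a::ab_group_add set \<Rightarrow> 'a set \<Rightarrow> 'a rel" where
  "coset_rel Z B = {(a, b). a \<in> Z \<and> b \<in> Z \<and> a - b \<in> B}"

definition quotient_vspace ::
  "('k \<Rightarrow> 'a \<Rightarrow> 'a) \<Rightarrow> 'a::ab_group_add set \<Rightarrow> 'a set \<Rightarrow> ('k, 'a set) vspace" where
  "quotient_vspace s Z B =
     (let R = coset_rel Z B in
      \<lparr>carr = Z // R,
       zer = R `` {0},
       vadd = (\<lambda>A B. \<Union>a\<in>A. \<Union>b\<in>B. R `` {a + b}),
       smul = (\<lambda>c A. \<Union>a\<in>A. R `` {s c a})\<rparr>)"

locale subquotient = vector_space s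
  for s :: "'k::field \<Rightarrow> 'a::ab_group_add \<Rightarrow> 'a" +
  fixes Z B :: "'a set"
  assumes subspace_Z: "subspace Z" and subspace_B: "subspace B"
begin

abbreviation coset :: "'a \<Rightarrow> 'a set" where "coset a \<equiv> coset_rel Z B `` {a}"

abbreviation Q :: "('k, 'a set) vspace" where "Q \<equiv> quotient_vspace s Z B"

lemma coset_self: "a \<in> Z \<Longrightarrow> a \<in> coset a"
  using subspace_0[OF subspace_B] by (auto simp: coset_rel_def)

text \<open>
  Independence of representatives, on which the operations of the quotient rest: \<open>B\<close> is closed under
  addition and subtraction, so \<open>a - c\<close> and \<open>b - c\<close> differ by an element of \<open>B\<close>.
\<close>

lemma coset_eqI:
  assumes "a \<in> Z" "b \<in> Z" "a - b \<in> B"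
  shows "coset a = coset b"
proof -
  have "a - c \<in> B \<longleftrightarrow> b - c \<in> B" for c
    using subspace_add[OF subspace_B, of "b - c" "a - b"] subspace_diff[OF subspace_B, of "a - c" "a - b"]
      assms(3) by auto
  then show ?thesis using assms(1,2) by (auto simp: coset_rel_def)
qed

lemma coset_eq_iff:
  assumes "a \<in> Z" "b \<in> Z"
  shows "coset a = coset b \<longleftrightarrow> a - b \<in> B"
  using coset_eqI[OF assms] coset_self[OF assms(2)] by (auto simp: coset_rel_def)

lemma carr_quotient: "carr Q = coset ` Z"
  by (auto simp: quotient_vspace_def quotient_def Let_def)

lemma zer_quotient: "zer Q = coset 0"
  by (simp add: quotient_vspace_def Let_def)

lemma vadd_quotient:
  assumes "a \<in> Z" "b \<in> Z"
  shows "vadd Q (coset a) (coset b) = coset (a + b)"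
proof -
  have "coset (a' + b') = coset (a + b)" if "a' \<in> coset a" "b' \<in> coset b" for a' b'
  proof (rule coset_eqI)
    have "a' \<in> Z" "b' \<in> Z" and B: "a - a' \<in> B" "b - b' \<in> B"
      using that by (auto simp: coset_rel_def)
    then show "a' + b' \<in> Z" "a + b \<in> Z"
      using assms by (auto intro: subspace_add[OF subspace_Z])
    have "- ((a - a') + (b - b')) \<in> B"
      by (intro subspace_neg[OF subspace_B] subspace_add[OF subspace_B] B)
    then show "a' + b' - (a + b) \<in> B" by (simp add: algebra_simps)
  qed
  then have "(\<Union>a'\<in>coset a. \<Union>b'\<in>coset b. coset (a' + b')) = coset (a + b)"
    using coset_self[OF assms(1)] coset_self[OF assms(2)] by blast
  then show ?thesis by (simp add: quotient_vspace_def Let_def)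
qed

lemma smul_quotient:
  assumes "a \<in> Z"
  shows "smul Q c (coset a) = coset (s c a)"
proof -
  have "coset (s c a') = coset (s c a)" if "a' \<in> coset a" for a'
  proof (rule coset_eqI)
    have "a' \<in> Z" and B: "a - a' \<in> B"
      using that by (auto simp: coset_rel_def)
    then show "s c a' \<in> Z" "s c a \<in> Z"
      using assms by (auto intro: subspace_scale[OF subspace_Z])
    have "- s c (a - a') \<in> B"
      by (intro subspace_neg[OF subspace_B] subspace_scale[OF subspace_B] B)
    then show "s c a' - s c a \<in> B" by (simp add: scale_right_diff_distrib)
  qed
  then have "(\<Union>a'\<in>coset a. coset (s c a')) = coset (s c a)"
    using coset_self[OF assms(1)] by blast
  then show ?thesis by (simp add: quotient_vspace_def Let_def)
qed

lemma is_vspace_quotient: "is_vspace Q"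
proof -
  note closed = subspace_0[OF subspace_Z] subspace_add[OF subspace_Z] subspace_scale[OF subspace_Z]
  have "\<exists>b\<in>Z. coset (a + b) = coset 0" if "a \<in> Z" for a
    using subspace_neg[OF subspace_Z that] by (intro bexI[of _ "- a"]) auto
  then show ?thesis
    unfolding is_vspace_def carr_quotient zer_quotient
    by (simp add: vadd_quotient smul_quotient closed ac_simps
        scale_right_distrib scale_left_distrib)
qed

lemma linear_map_coset:
  assumes "linear_map X (subspace_of s Z) f"
  shows "linear_map X Q (\<lambda>a. coset (f a))"
  using assms is_vspace_quotient
  by (simp add: linear_map_def subspace_of_def carr_quotient vadd_quotient smul_quotient)

lemma vker_coset:
  assumes "linear_map X (subspace_of s Z) f"
  shows "vker X Q (\<lambda>a. coset (f a)) = {a \<in> carr X. f a \<in> B}"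
proof -
  have "coset (f a) = coset 0 \<longleftrightarrow> f a \<in> B" if "a \<in> carr X" for a
    using assms that subspace_0[OF subspace_Z]
    by (simp add: linear_map_def subspace_of_def coset_eq_iff)
  then show ?thesis
    unfolding vker_def zer_quotient by blast
qed

end

section \<open>Cocycles and coboundaries\<close>

definition coboundaries ::
  "('k::field \<Rightarrow> 'g::ab_group_add \<Rightarrow> 'g) \<Rightarrow> ('g \<Rightarrow> 'g \<Rightarrow> 'g) \<Rightarrow> ('g \<Rightarrow> 'g)
    \<Rightarrow> ('k \<Rightarrow> 'v::ab_group_add \<Rightarrow> 'v) \<Rightarrow> ('g \<Rightarrow> 'v \<Rightarrow> 'v) \<Rightarrow> ('v \<Rightarrow> 'v)
    \<Rightarrow> (('g \<Rightarrow> 'g \<Rightarrow> 'v) \<times> ('g \<Rightarrow> 'v)) set" where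
  "coboundaries sG br N sV \<rho> S =
     {(\<chi>, F). \<exists>\<phi>. Vector_Spaces.linear sG sV \<phi> \<and>
        (\<forall>x y. \<chi> x y = \<rho> x (\<phi> y) - \<rho> y (\<phi> x) - \<phi> (br x y)) \<and>
        (\<forall>x. F x = S (\<phi> x) - \<phi> (N x))}"

lemma cohomologous_eq_coset_rel:
  "cohomologous sG br N sV \<rho> S = coset_rel (cocycles sG br N sV \<rho> S) (coboundaries sG br N sV \<rho> S)"
proof -
  have "(a, b) \<in> cohomologous sG br N sV \<rho> S \<longleftrightarrow>
      (a, b) \<in> coset_rel (cocycles sG br N sV \<rho> S) (coboundaries sG br N sV \<rho> S)" for a b
    by (cases a; cases b) (simp add: cohomologous_def coset_rel_def coboundaries_def)
  then show ?thesis by (simp add: set_eq_iff split_paired_all)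
qed

lemma H2_eq_quotient:
  "H2 sG br N sV \<rho> S =
     quotient_vspace (cochain_scale sV) (cocycles sG br N sV \<rho> S) (coboundaries sG br N sV \<rho> S)"
  by (simp add: H2_def quotient_vspace_def cohomologous_eq_coset_rel)

context nijenhuis_representation
begin

text \<open>
  The left-hand sides of the two cocycle conditions. They are linear in the cochain, so the cocycles
  form a subspace; giving them names lets further closure properties be stated as identities between
  defects.
\<close>

definition lie_defect :: "('g \<Rightarrow> 'g \<Rightarrow> 'v) \<Rightarrow> 'g \<Rightarrow> 'g \<Rightarrow> 'g \<Rightarrow> 'v" where
  "lie_defect \<chi> x y z =
     \<rho> x (\<chi> y z) + \<rho> y (\<chi> z x) + \<rho> z (\<chi> x y) - \<chi> (br x y) z - \<chi> (br y z) x - \<chi> (br z x) y"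

definition nijenhuis_defect :: "('g \<Rightarrow> 'g \<Rightarrow> 'v) \<Rightarrow> ('g \<Rightarrow> 'v) \<Rightarrow> 'g \<Rightarrow> 'g \<Rightarrow> 'v" where
  "nijenhuis_defect \<chi> F x y =
     \<chi> (N x) (N y) - S (\<chi> (N x) y + \<chi> x (N y) - S (\<chi> x y))
     - F (br (N x) y + br x (N y) - N (br x y))
     + \<rho> (N x) (F y) - \<rho> (N y) (F x) - S (\<rho> x (F y) - \<rho> y (F x) - F (br x y))"

lemma cocycles_iff:
  "(\<chi>, F) \<in> cocycles sG br N sV \<rho> S \<longleftrightarrow>
     bilinear_map sG sG sV \<chi> \<and> (\<forall>x. \<chi> x x = 0) \<and> Vector_Spaces.linear sG sV F \<and>
     (\<forall>x y z. lie_defect \<chi> x y z = 0) \<and> (\<forall>x y. nijenhuis_defect \<chi> F x y = 0)"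
  by (simp add: cocycles_def lie_defect_def nijenhuis_defect_def)

lemmas linear_simps =
  linear_laws[OF linear_N] linear_laws[OF linear_S] bilinear_laws[OF bilinear_rho]
  bilinear_laws[OF bilinear]

lemma vector_space_sG: "vector_space sG" and vector_space_sV: "vector_space sV"
  using linear_domain[OF linear_N] linear_domain[OF linear_S] .

lemma vector_space_cochains:
  "vector_space (cochain_scale sV :: 'k \<Rightarrow> ('g \<Rightarrow> 'g \<Rightarrow> 'v) \<times> ('g \<Rightarrow> 'v) \<Rightarrow> _)"
  by (intro vector_space_prod_scale vector_space_fun_scale vector_space_sV)

lemma subspace_cocycles:
  "module.subspace (cochain_scale sV) (cocycles sG br N sV \<rho> S)"
proof (rule subspace_carrierI[OF vector_space_cochains])
  have "(\<lambda>x y. 0, \<lambda>x. 0) \<in> cocycles sG br N sV \<rho> S"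
    by (auto simp: cocycles_iff lie_defect_def nijenhuis_defect_def linear_simps
        intro!: bilinear_mapI linearI vector_space_sG vector_space_sV)
  then show "0 \<in> cocycles sG br N sV \<rho> S"
    by (simp add: zero_prod_def zero_fun_def)
next
  fix a b assume ab: "a \<in> cocycles sG br N sV \<rho> S" "b \<in> cocycles sG br N sV \<rho> S"
  obtain \<chi> F \<chi>' F' where eqs: "a = (\<chi>, F)" "b = (\<chi>', F')" by fastforce
  have a: "bilinear_map sG sG sV \<chi>" "\<And>x. \<chi> x x = 0" "Vector_Spaces.linear sG sV F"
    "\<And>x y z. lie_defect \<chi> x y z = 0" "\<And>x y. nijenhuis_defect \<chi> F x y = 0"
    using ab(1) by (simp_all add: eqs cocycles_iff)
  have b: "bilinear_map sG sG sV \<chi>'" "\<And>x. \<chi>' x x = 0" "Vector_Spaces.linear sG sV F'"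
    "\<And>x y z. lie_defect \<chi>' x y z = 0" "\<And>x y. nijenhuis_defect \<chi>' F' x y = 0"
    using ab(2) by (simp_all add: eqs cocycles_iff)
  note laws = bilinear_laws[OF a(1)] bilinear_laws[OF b(1)] linear_laws[OF a(3)] linear_laws[OF b(3)]
  have "lie_defect (\<chi> + \<chi>') x y z = lie_defect \<chi> x y z + lie_defect \<chi>' x y z" for x y z
    by (simp add: lie_defect_def linear_simps laws algebra_simps)
  moreover have "nijenhuis_defect (\<chi> + \<chi>') (F + F') x y
      = nijenhuis_defect \<chi> F x y + nijenhuis_defect \<chi>' F' x y" for x y
    by (simp add: nijenhuis_defect_def linear_simps laws algebra_simps)
  moreover have "bilinear_map sG sG sV (\<chi> + \<chi>')"
    by (rule bilinear_mapI) (simp_all add: laws vector_space_sG vector_space_sV V.scale_right_distrib)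
  moreover have "Vector_Spaces.linear sG sV (F + F')"
    by (rule linearI) (simp_all add: laws vector_space_sG vector_space_sV V.scale_right_distrib)
  ultimately show "a + b \<in> cocycles sG br N sV \<rho> S"
    by (simp add: eqs cocycles_iff a b)
next
  fix c a assume "a \<in> cocycles sG br N sV \<rho> S"
  moreover obtain \<chi> F where eq: "a = (\<chi>, F)" by fastforce
  ultimately have a: "bilinear_map sG sG sV \<chi>" "\<And>x. \<chi> x x = 0" "Vector_Spaces.linear sG sV F"
    "\<And>x y z. lie_defect \<chi> x y z = 0" "\<And>x y. nijenhuis_defect \<chi> F x y = 0"
    by (simp_all add: cocycles_iff)
  let ?\<chi> = "\<lambda>x y. sV c (\<chi> x y)" and ?F = "\<lambda>x. sV c (F x)"
  note laws = bilinear_laws[OF a(1)] linear_laws[OF a(3)]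
    V.scale_right_distrib V.scale_right_diff_distrib
  have "lie_defect ?\<chi> x y z = sV c (lie_defect \<chi> x y z)" for x y z
    by (simp add: lie_defect_def linear_simps laws)
  moreover have "nijenhuis_defect ?\<chi> ?F x y = sV c (nijenhuis_defect \<chi> F x y)" for x y
    by (simp add: nijenhuis_defect_def linear_simps laws)
  moreover have "bilinear_map sG sG sV ?\<chi>"
    by (rule bilinear_mapI) (simp_all add: laws vector_space_sG vector_space_sV mult.commute)
  moreover have "Vector_Spaces.linear sG sV ?F"
    by (rule linearI) (simp_all add: laws vector_space_sG vector_space_sV mult.commute)
  ultimately show "cochain_scale sV c a \<in> cocycles sG br N sV \<rho> S"
    by (simp add: eq cocycles_iff a prod_scale_def fun_scale_def)
qed

lemma subspace_coboundaries:
  "module.subspace (cochain_scale sV) (coboundaries sG br N sV \<rho> S)"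
proof (rule subspace_carrierI[OF vector_space_cochains])
  have "Vector_Spaces.linear sG sV (\<lambda>x. 0)"
    by (rule linearI) (simp_all add: vector_space_sG vector_space_sV)
  then show "0 \<in> coboundaries sG br N sV \<rho> S"
    by (auto simp: coboundaries_def zero_prod_def linear_simps intro!: exI[of _ "\<lambda>x. 0"])
next
  fix a b assume "a \<in> coboundaries sG br N sV \<rho> S" "b \<in> coboundaries sG br N sV \<rho> S"
  moreover obtain \<chi> F \<chi>' F' where eqs: "a = (\<chi>, F)" "b = (\<chi>', F')" by fastforce
  ultimately obtain \<phi> \<phi>' where
    a: "Vector_Spaces.linear sG sV \<phi>" "\<And>x y. \<chi> x y = \<rho> x (\<phi> y) - \<rho> y (\<phi> x) - \<phi> (br x y)"
      "\<And>x. F x = S (\<phi> x) - \<phi> (N x)" and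
    b: "Vector_Spaces.linear sG sV \<phi>'" "\<And>x y. \<chi>' x y = \<rho> x (\<phi>' y) - \<rho> y (\<phi>' x) - \<phi>' (br x y)"
      "\<And>x. F' x = S (\<phi>' x) - \<phi>' (N x)"
    by (auto simp: coboundaries_def)
  have "Vector_Spaces.linear sG sV (\<lambda>x. \<phi> x + \<phi>' x)"
    by (rule linearI) (simp_all add: vector_space_sG vector_space_sV V.scale_right_distrib
        linear_laws[OF a(1)] linear_laws[OF b(1)])
  then show "a + b \<in> coboundaries sG br N sV \<rho> S"
    by (auto simp: coboundaries_def eqs a(2,3) b(2,3) linear_simps
        intro!: exI[of _ "\<lambda>x. \<phi> x + \<phi>' x"])
next
  fix c a assume "a \<in> coboundaries sG br N sV \<rho> S"
  moreover obtain \<chi> F where eq: "a = (\<chi>, F)" by fastforce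
  ultimately obtain \<phi> where
    a: "Vector_Spaces.linear sG sV \<phi>" "\<And>x y. \<chi> x y = \<rho> x (\<phi> y) - \<rho> y (\<phi> x) - \<phi> (br x y)"
      "\<And>x. F x = S (\<phi> x) - \<phi> (N x)"
    by (auto simp: coboundaries_def)
  have "Vector_Spaces.linear sG sV (\<lambda>x. sV c (\<phi> x))"
    by (rule linearI) (simp_all add: vector_space_sG vector_space_sV V.scale_right_distrib
        linear_laws[OF a(1)] mult.commute)
  then show "cochain_scale sV c a \<in> coboundaries sG br N sV \<rho> S"
    by (auto simp: coboundaries_def eq a(2,3) linear_simps prod_scale_def fun_scale_def
        V.scale_right_diff_distrib intro!: exI[of _ "\<lambda>x. sV c (\<phi> x)"])
qed

section \<open>Spaces of derivations over the base\<close>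

lemma der_coeff_iff:
  "d \<in> der_coeff sG br N sV \<rho> S \<longleftrightarrow>
     Vector_Spaces.linear sG sV d \<and> (\<forall>x. S (d x) = d (N x)) \<and>
     (\<forall>x y. d (br x y) = \<rho> x (d y) - \<rho> y (d x))"
  by (simp add: der_coeff_def fun_eq_iff)

lemma compatible_der_iff:
  "(DV, DG) \<in> compatible_der sG br N sV \<rho> S \<longleftrightarrow>
     Vector_Spaces.linear sV sV DV \<and> (\<forall>v. S (DV v) = DV (S v)) \<and>
     Vector_Spaces.linear sG sG DG \<and> (\<forall>x y. DG (br x y) = br (DG x) y + br x (DG y)) \<and>
     (\<forall>x. N (DG x) = DG (N x)) \<and> (\<forall>x v. DV (\<rho> x v) = \<rho> (DG x) v + \<rho> x (DV v))"
  using linear_laws(4)[of sV sV DV] by (auto simp: compatible_der_def der_def fun_eq_iff)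

lemma subspace_der_coeff: "module.subspace (fun_scale sV) (der_coeff sG br N sV \<rho> S)"
proof (rule subspace_carrierI)
  show "vector_space (fun_scale sV)"
    by (intro vector_space_fun_scale vector_space_sV)
next
  show "0 \<in> der_coeff sG br N sV \<rho> S"
    by (simp add: der_coeff_iff Vector_Spaces.linear_iff linear_simps vector_space_sV vector_space_sG)
next
  fix d d' assume "d \<in> der_coeff sG br N sV \<rho> S" "d' \<in> der_coeff sG br N sV \<rho> S"
  then show "d + d' \<in> der_coeff sG br N sV \<rho> S"
    by (simp add: der_coeff_iff Vector_Spaces.linear_iff linear_simps V.scale_right_distrib)
next
  fix c d assume "d \<in> der_coeff sG br N sV \<rho> S"
  then show "fun_scale sV c d \<in> der_coeff sG br N sV \<rho> S"
    by (simp add: der_coeff_iff Vector_Spaces.linear_iff linear_simps fun_scale_def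
        V.scale_right_distrib V.scale_right_diff_distrib mult.commute)
qed

lemma subspace_compatible_der:
  "module.subspace (prod_scale (fun_scale sV) (fun_scale sG)) (compatible_der sG br N sV \<rho> S)"
proof (rule subspace_carrierI)
  show "vector_space (prod_scale (fun_scale sV) (fun_scale sG))"
    by (intro vector_space_prod_scale vector_space_fun_scale vector_space_sV vector_space_sG)
next
  show "0 \<in> compatible_der sG br N sV \<rho> S"
    by (simp add: zero_prod_def compatible_der_iff Vector_Spaces.linear_iff linear_simps
        vector_space_sV vector_space_sG)
next
  fix a b assume "a \<in> compatible_der sG br N sV \<rho> S" "b \<in> compatible_der sG br N sV \<rho> S"
  then show "a + b \<in> compatible_der sG br N sV \<rho> S"
    by (cases a, cases b)
      (simp add: compatible_der_iff Vector_Spaces.linear_iff linear_simps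
        V.scale_right_distrib scale_right_distrib)
next
  fix c a assume "a \<in> compatible_der sG br N sV \<rho> S"
  then show "prod_scale (fun_scale sV) (fun_scale sG) c a \<in> compatible_der sG br N sV \<rho> S"
    by (cases a)
      (simp add: compatible_der_iff Vector_Spaces.linear_iff linear_simps
        V.scale_right_distrib scale_right_distrib prod_scale_def fun_scale_def mult.commute)
qed

section \<open>The action of pairs of derivations on cocycles\<close>

text \<open>
  A compatible pair acts as a derivation on \<open>\<gg>\<close> and \<open>V\<close> together and respects \<open>br\<close>, \<open>\<rho>\<close>, \<open>N\<close> and \<open>S\<close>.
  Each defect is built from these and the cochain, so by the Leibniz rule the defect of the twisted
  cochain is \<open>DV\<close> of the original defect minus the original defects with one argument moved by \<open>DG\<close>.
\<close>

lemma twisted_pair_cocycle: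
  assumes "(\<chi>, F) \<in> cocycles sG br N sV \<rho> S"
    and "(DV, DG) \<in> compatible_der sG br N sV \<rho> S"
  shows "twisted_pair (\<chi>, F) (DV, DG) \<in> cocycles sG br N sV \<rho> S"
proof -
  have c: "bilinear_map sG sG sV \<chi>" "\<And>x. \<chi> x x = 0" "Vector_Spaces.linear sG sV F"
    "\<And>x y z. lie_defect \<chi> x y z = 0" "\<And>x y. nijenhuis_defect \<chi> F x y = 0"
    using assms(1) by (simp_all add: cocycles_iff)
  have D: "Vector_Spaces.linear sV sV DV" "Vector_Spaces.linear sG sG DG"
    "\<And>x y. DG (br x y) = br (DG x) y + br x (DG y)"
    "\<And>x v. DV (\<rho> x v) = \<rho> (DG x) v + \<rho> x (DV v)"
    and comm: "S \<circ> DV = DV \<circ> S" "N \<circ> DG = DG \<circ> N"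
    using assms(2) by (auto simp: compatible_der_def der_def)
  have comm': "DV (S v) = S (DV v)" "DG (N x) = N (DG x)" for v x
    using comm by (metis comp_apply)+
  note laws = bilinear_laws[OF c(1)] linear_laws[OF c(3)] linear_laws[OF D(1)] linear_laws[OF D(2)]
    V.scale_right_distrib V.scale_right_diff_distrib D(3,4) comm'
  have antisym: "\<chi> y x = - \<chi> x y" for x y
    using alternating_imp_antisymmetric c(1,2) by blast
  let ?\<chi> = "\<lambda>x y. DV (\<chi> x y) - \<chi> (DG x) y - \<chi> x (DG y)" and ?F = "\<lambda>x. DV (F x) - F (DG x)"
  have "lie_defect ?\<chi> x y z = DV (lie_defect \<chi> x y z)
      - lie_defect \<chi> (DG x) y z - lie_defect \<chi> x (DG y) z - lie_defect \<chi> x y (DG z)" for x y z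
    unfolding lie_defect_def by (simp add: linear_simps laws algebra_simps)
  moreover have "nijenhuis_defect ?\<chi> ?F x y = DV (nijenhuis_defect \<chi> F x y)
      - nijenhuis_defect \<chi> F (DG x) y - nijenhuis_defect \<chi> F x (DG y)" for x y
    unfolding nijenhuis_defect_def by (simp add: linear_simps laws algebra_simps)
  moreover have "bilinear_map sG sG sV ?\<chi>"
    by (rule bilinear_mapI) (simp_all add: laws vector_space_sG vector_space_sV)
  moreover have "Vector_Spaces.linear sG sV ?F"
    by (rule linearI) (simp_all add: laws vector_space_sG vector_space_sV)
  moreover have "?\<chi> x x = 0" for x
    using antisym[of "DG x" x] by (simp add: c(2) laws)
  ultimately show ?thesis
    by (simp add: cocycles_iff twisted_pair_def c(4,5) laws)
qed

lemma linear_map_twisted_pair: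
  assumes "(\<chi>, F) \<in> cocycles sG br N sV \<rho> S"
  shows "linear_map
    (subspace_of (prod_scale (fun_scale sV) (fun_scale sG)) (compatible_der sG br N sV \<rho> S))
    (subspace_of (cochain_scale sV) (cocycles sG br N sV \<rho> S))
    (twisted_pair (\<chi>, F))"
proof -
  have c: "bilinear_map sG sG sV \<chi>" "Vector_Spaces.linear sG sV F"
    using assms(1) by (simp_all add: cocycles_iff)
  note laws = bilinear_laws[OF c(1)] linear_laws[OF c(2)] V.scale_right_diff_distrib
  have "is_vspace (subspace_of (prod_scale (fun_scale sV) (fun_scale sG))
      (compatible_der sG br N sV \<rho> S))"
    by (intro is_vspace_subspace_of subspace_compatible_der vector_space_prod_scale vector_space_fun_scale
        vector_space_sG vector_space_sV)
  moreover have "is_vspace (subspace_of (cochain_scale sV) (cocycles sG br N sV \<rho> S))"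
    by (intro is_vspace_subspace_of vector_space_cochains subspace_cocycles)
  ultimately show ?thesis
    using twisted_pair_cocycle[OF assms(1)]
    by (auto simp: linear_map_def subspace_of_def twisted_pair_def prod_scale_def fun_scale_def
        fun_eq_iff laws)
qed

end

section \<open>Split coordinates on the extension\<close>

text \<open>
  With a section fixed, every element of \<open>\<ee>\<close> is \<open>s x + i v\<close> for unique \<open>x\<close> and \<open>v\<close>, and \<open>p\<close> and the
  retraction below are the two coordinates. The rules collected in \<open>expand\<close> compute the bracket and
  the operator of \<open>\<ee>\<close> in these coordinates; applying \<open>p\<close> or the retraction to an identity in \<open>\<ee>\<close> then
  gives its component in \<open>\<gg>\<close> or in \<open>V\<close>.
\<close>

locale split_abelian_extension =
  abelian_extension sG brG N sV \<rho> S sE brE U i p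
  for sG :: "'k::field \<Rightarrow> 'g::ab_group_add \<Rightarrow> 'g" and brG :: "'g \<Rightarrow> 'g \<Rightarrow> 'g"
    and N :: "'g \<Rightarrow> 'g"
    and sV :: "'k \<Rightarrow> 'v::ab_group_add \<Rightarrow> 'v" and \<rho> :: "'g \<Rightarrow> 'v \<Rightarrow> 'v" and S :: "'v \<Rightarrow> 'v"
    and sE :: "'k \<Rightarrow> 'e::ab_group_add \<Rightarrow> 'e" and brE :: "'e \<Rightarrow> 'e \<Rightarrow> 'e"
    and U :: "'e \<Rightarrow> 'e" and i :: "'v \<Rightarrow> 'e" and p :: "'e \<Rightarrow> 'g" +
  fixes s :: "'g \<Rightarrow> 'e"
  assumes section_s: "linear_section sG sE p s"
begin

definition retraction :: "'e \<Rightarrow> 'v" where "retraction e = inv i (e - s (p e))"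

abbreviation "\<chi> \<equiv> ext_chi brG brE i s"
abbreviation "F \<equiv> ext_F N U i s"

lemma linear_i: "Vector_Spaces.linear sV sE i" and linear_p: "Vector_Spaces.linear sE sG p"
  and linear_s: "Vector_Spaces.linear sG sE s"
  using hom_i hom_p section_s by (simp_all add: nijenhuis_hom_def linear_section_def)

lemma vector_space_sE: "vector_space sE"
  using linear_domain[OF linear_p] .

lemmas split_linear_simps =
  linear_laws[OF linear_i] linear_laws[OF linear_p] linear_laws[OF linear_s]
  linear_laws[OF E.linear_N] bilinear_laws[OF E.bilinear]

lemma p_s [simp]: "p (s x) = x"
  using section_s by (simp add: linear_section_def fun_eq_iff)

lemma p_i [simp]: "p (i v) = 0"
  using exact_middle by auto

lemma i_eq_iff [simp]: "i u = i v \<longleftrightarrow> u = v"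
  using inj_i by (simp add: inj_eq)

lemma p_br: "p (brE e f) = brG (p e) (p f)" and p_U: "p (U e) = N (p e)"
  using hom_p by (auto simp: nijenhuis_hom_def fun_eq_iff)

lemma br_ii: "brE (i u) (i v) = 0" and U_i: "U (i v) = i (S v)"
  using hom_i by (simp_all add: nijenhuis_hom_def fun_eq_iff split_linear_simps)

lemma i_inv: "p e = 0 \<Longrightarrow> i (inv i e) = e"
  using exact_middle by (simp add: f_inv_into_f)

lemma i_retraction: "i (retraction e) = e - s (p e)"
  by (simp add: retraction_def i_inv split_linear_simps)

lemma split: "e = s (p e) + i (retraction e)"
  by (simp add: i_retraction)

lemma retraction_s [simp]: "retraction (s x) = 0" and retraction_i [simp]: "retraction (i v) = v"
  using inj_i inv_f_f[OF inj_i, of 0] by (simp_all add: retraction_def split_linear_simps)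

text \<open>
  Since \<open>i\<close> is injective, linearity may be checked for \<open>i \<circ> retraction\<close>, the linear map \<open>e - s (p e)\<close>.
\<close>

lemma linear_retraction: "Vector_Spaces.linear sE sV retraction"
proof (rule linearI[OF vector_space_sE vector_space_sV])
  have "i (retraction (e + f)) = i (retraction e + retraction f)" for e f
    by (simp add: i_retraction split_linear_simps)
  then show "retraction (e + f) = retraction e + retraction f" for e f by simp
  have "i (retraction (sE c e)) = i (sV c (retraction e))" for c e
    by (simp add: i_retraction split_linear_simps E.scale_right_diff_distrib)
  then show "retraction (sE c e) = sV c (retraction e)" for c e by simp
qed

lemma chi_eq: "\<chi> x y = retraction (brE (s x) (s y))" and F_eq: "F x = retraction (U (s x))"
  by (simp_all add: ext_chi_def ext_F_def retraction_def p_br p_U)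

lemma br_ss: "brE (s x) (s y) = s (brG x y) + i (\<chi> x y)" and U_s: "U (s x) = s (N x) + i (F x)"
  by (simp_all add: chi_eq F_eq i_retraction p_br p_U)

lemma br_si: "brE (s x) (i v) = i (\<rho> x v)"
  using action[OF section_s] by simp

lemma br_is: "brE (i v) (s x) = - i (\<rho> x v)"
  using alternating_imp_antisymmetric[OF E.bilinear E.alternating, of "i v" "s x"] by (simp add: br_si)

lemmas expand = br_ss br_si br_is br_ii U_s U_i split_linear_simps linear_laws[OF linear_retraction]

lemma bilinear_chi: "bilinear_map sG sG sV \<chi>"
  by (rule bilinear_mapI)
    (simp_all add: vector_space_sG vector_space_sV chi_eq split_linear_simps linear_laws[OF linear_retraction])

lemma linear_F: "Vector_Spaces.linear sG sV F"
  by (rule linearI)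
    (simp_all add: vector_space_sG vector_space_sV F_eq split_linear_simps linear_laws[OF linear_retraction])

lemmas cocycle_simps = bilinear_laws[OF bilinear_chi] linear_laws[OF linear_F]

text \<open>
  The two cocycle conditions are the \<open>V\<close>-components of the Jacobi identity and of the Nijenhuis
  identity of \<open>\<ee>\<close>, taken at elements of the image of \<open>s\<close>.
\<close>

lemma chi_F_cocycle: "(\<chi>, F) \<in> cocycles sG brG N sV \<rho> S"
proof -
  have alt: "\<chi> x x = 0" for x
    by (simp add: chi_eq E.alternating linear_laws[OF linear_retraction])
  have antisym: "\<chi> y x = - \<chi> x y" for x y
    using alternating_imp_antisymmetric[OF bilinear_chi] alt by blast
  have "lie_defect \<chi> x y z = 0" for x y z
  proof -
    have "0 = retraction (brE (s x) (brE (s y) (s z)) + brE (s y) (brE (s z) (s x)) + brE (s z) (brE (s x) (s y)))"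
      by (simp add: E.jacobi linear_laws[OF linear_retraction])
    also have "\<dots> = lie_defect \<chi> x y z"
      by (simp add: lie_defect_def expand antisym[of "brG x y"] antisym[of "brG y z"]
          antisym[of "brG z x"])
    finally show ?thesis by simp
  qed
  moreover have "nijenhuis_defect \<chi> F x y = 0" for x y
  proof -
    have "0 = retraction (brE (U (s x)) (U (s y)))
        - retraction (U (brE (U (s x)) (s y) + brE (s x) (U (s y)) - U (brE (s x) (s y))))"
      unfolding E.nijenhuis by simp
    also have "\<dots> = nijenhuis_defect \<chi> F x y"
      unfolding nijenhuis_defect_def
      by (simp add: expand linear_simps cocycle_simps algebra_simps)
    finally show ?thesis by simp
  qed
  ultimately show ?thesis
    by (simp add: cocycles_iff bilinear_chi linear_F alt)
qed

section \<open>The four terms of the sequence\<close>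

lemma der_preserving_iff:
  "D \<in> der_preserving sE brE U i \<longleftrightarrow>
     Vector_Spaces.linear sE sE D \<and> (\<forall>e f. D (brE e f) = brE (D e) f + brE e (D f)) \<and>
     (\<forall>e. U (D e) = D (U e)) \<and> (\<forall>v. p (D (i v)) = 0)"
proof -
  have "D ` range i \<subseteq> range i \<longleftrightarrow> (\<forall>v. D (i v) \<in> range i)" by blast
  also have "\<dots> \<longleftrightarrow> (\<forall>v. p (D (i v)) = 0)" by (simp add: exact_middle)
  finally have "D ` range i \<subseteq> range i \<longleftrightarrow> (\<forall>v. p (D (i v)) = 0)" .
  then show ?thesis by (simp add: der_preserving_def der_def fun_eq_iff)
qed

lemma subspace_der_preserving: "module.subspace (fun_scale sE) (der_preserving sE brE U i)"
proof (rule subspace_carrierI)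
  show "vector_space (fun_scale sE)"
    by (intro vector_space_fun_scale vector_space_sE)
next
  show "0 \<in> der_preserving sE brE U i"
    by (simp add: der_preserving_iff Vector_Spaces.linear_iff split_linear_simps vector_space_sE)
next
  fix D D' assume "D \<in> der_preserving sE brE U i" "D' \<in> der_preserving sE brE U i"
  then show "D + D' \<in> der_preserving sE brE U i"
    by (simp add: der_preserving_iff Vector_Spaces.linear_iff split_linear_simps E.scale_right_distrib)
next
  fix c D assume "D \<in> der_preserving sE brE U i"
  then show "fun_scale sE c D \<in> der_preserving sE brE U i"
    by (simp add: der_preserving_iff Vector_Spaces.linear_iff split_linear_simps
        E.scale_right_distrib fun_scale_def mult.commute)
qed

abbreviation "coeff_ders \<equiv> subspace_of (fun_scale sV) (der_coeff sG brG N sV \<rho> S)"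
abbreviation "ext_ders \<equiv> subspace_of (fun_scale sE) (der_preserving sE brE U i)"
abbreviation "pair_ders \<equiv>
  subspace_of (prod_scale (fun_scale sV) (fun_scale sG)) (compatible_der sG brG N sV \<rho> S)"

lemma is_vspace_coeff_ders: "is_vspace coeff_ders"
  by (intro is_vspace_subspace_of subspace_der_coeff vector_space_fun_scale vector_space_sV)

lemma is_vspace_ext_ders: "is_vspace ext_ders"
  by (intro is_vspace_subspace_of subspace_der_preserving vector_space_fun_scale vector_space_sE)

lemma is_vspace_pair_ders: "is_vspace pair_ders"
  by (intro is_vspace_subspace_of subspace_compatible_der vector_space_prod_scale
      vector_space_fun_scale vector_space_sV vector_space_sG)

section \<open>Lifting a compatible pair of derivations\<close>

text \<open>
  The endomorphism of \<open>\<ee>\<close> with matrix entries \<open>DG\<close> and \<open>DV\<close> on the diagonal and \<open>\<phi> : \<gg> \<rightarrow> V\<close> off it.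
\<close>

definition lift :: "('g \<Rightarrow> 'v) \<Rightarrow> ('v \<Rightarrow> 'v) \<Rightarrow> ('g \<Rightarrow> 'g) \<Rightarrow> 'e \<Rightarrow> 'e" where
  "lift \<phi> DV DG e = s (DG (p e)) + i (\<phi> (p e) + DV (retraction e))"

lemma eta_lift:
  assumes "Vector_Spaces.linear sG sV \<phi>" "Vector_Spaces.linear sV sV DV"
    "Vector_Spaces.linear sG sG DG"
  shows "eta i p s (lift \<phi> DV DG) = (DV, DG)"
  using inj_i
  by (auto simp: eta_def lift_def fun_eq_iff split_linear_simps linear_laws[OF assms(1)]
      linear_laws[OF assms(2)] linear_laws[OF assms(3)])

text \<open>
  In coordinates the derivation rule for \<open>s x + i u\<close> and \<open>s y + i v\<close> splits into three parts: the
  \<open>\<gg>\<close>-component is the derivation rule for \<open>DG\<close>, the terms containing \<open>u\<close> or \<open>v\<close> are the compatibility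
  of \<open>DV\<close> and \<open>DG\<close> with \<open>\<rho>\<close>, and what remains in \<open>V\<close> is the hypothesis on \<open>\<chi>\<close>. Likewise the
  hypothesis on \<open>F\<close> is what remains of commutation with \<open>U\<close>.
\<close>

lemma lift_in_der_preserving:
  assumes pair: "(DV, DG) \<in> compatible_der sG brG N sV \<rho> S"
    and \<phi>: "Vector_Spaces.linear sG sV \<phi>"
    and chi: "\<And>x y. DV (\<chi> x y) - \<chi> (DG x) y - \<chi> x (DG y) = \<rho> x (\<phi> y) - \<rho> y (\<phi> x) - \<phi> (brG x y)"
    and F: "\<And>x. DV (F x) - F (DG x) = S (\<phi> x) - \<phi> (N x)"
  shows "lift \<phi> DV DG \<in> der_preserving sE brE U i"
proof -
  have D: "Vector_Spaces.linear sV sV DV" "Vector_Spaces.linear sG sG DG"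
    "\<And>v. S (DV v) = DV (S v)" "\<And>x. N (DG x) = DG (N x)"
    "\<And>x y. DG (brG x y) = brG (DG x) y + brG x (DG y)"
    "\<And>x v. DV (\<rho> x v) = \<rho> (DG x) v + \<rho> x (DV v)"
    using pair by (auto simp: compatible_der_iff)
  note lin = linear_laws[OF D(1)] linear_laws[OF D(2)] linear_laws[OF \<phi>] linear_laws[OF linear_retraction]
    split_linear_simps linear_simps
  have "Vector_Spaces.linear sE sE (lift \<phi> DV DG)"
    by (rule linearI) (simp_all add: vector_space_sE lift_def lin E.scale_right_distrib)
  moreover have "lift \<phi> DV DG (brE e f) = brE (lift \<phi> DV DG e) f + brE e (lift \<phi> DV DG f)" for e f
  proof -
    obtain x u y v where ef: "e = s x + i u" "f = s y + i v"
      using split by metis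
    have DV_chi: "DV (\<chi> x y) = \<rho> x (\<phi> y) - \<rho> y (\<phi> x) - \<phi> (brG x y) + \<chi> (DG x) y + \<chi> x (DG y)"
      using chi[of x y] by (simp add: algebra_simps)
    show ?thesis
      by (simp add: ef lift_def expand lin D(5,6) DV_chi algebra_simps)
  qed
  moreover have "U (lift \<phi> DV DG e) = lift \<phi> DV DG (U e)" for e
  proof -
    obtain x u where e: "e = s x + i u"
      using split by metis
    have DV_F: "DV (F x) = S (\<phi> x) - \<phi> (N x) + F (DG x)"
      using F[of x] by (simp add: algebra_simps)
    show ?thesis
      by (simp add: e lift_def expand lin D(3,4) DV_F algebra_simps)
  qed
  moreover have "p (lift \<phi> DV DG (i v)) = 0" for v
    by (simp add: lift_def lin)
  ultimately show ?thesis by (simp add: der_preserving_iff)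
qed

text \<open>
  The converse. The entries of the matrix are \<open>DV = retraction \<circ> D \<circ> i\<close>, \<open>DG = p \<circ> D \<circ> s\<close> and
  \<open>\<phi> = retraction \<circ> D \<circ> s\<close>; the remaining entry \<open>p \<circ> D \<circ> i\<close> vanishes because \<open>D\<close> preserves \<open>V\<close>. Each
  claimed property is a component of the derivation rule or of commutation with \<open>U\<close>, evaluated at
  elements \<open>s x\<close> or \<open>i v\<close>.
\<close>

lemma eq_lift_of_eta:
  assumes "D \<in> der_preserving sE brE U i"
  obtains DV DG \<phi> where "eta i p s D = (DV, DG)" "(DV, DG) \<in> compatible_der sG brG N sV \<rho> S"
    "Vector_Spaces.linear sG sV \<phi>" "D = lift \<phi> DV DG"
    "\<And>x y. DV (\<chi> x y) - \<chi> (DG x) y - \<chi> x (DG y) = \<rho> x (\<phi> y) - \<rho> y (\<phi> x) - \<phi> (brG x y)"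
    "\<And>x. DV (F x) - F (DG x) = S (\<phi> x) - \<phi> (N x)"
proof -
  have D: "Vector_Spaces.linear sE sE D" "\<And>e f. D (brE e f) = brE (D e) f + brE e (D f)"
    "\<And>e. U (D e) = D (U e)" "\<And>v. p (D (i v)) = 0"
    using assms by (auto simp: der_preserving_iff)
  define DV where "DV = (\<lambda>v. retraction (D (i v)))"
  define DG where "DG = (\<lambda>x. p (D (s x)))"
  define \<phi> where "\<phi> = (\<lambda>x. retraction (D (s x)))"
  have D_i: "D (i v) = i (DV v)" for v
    by (simp add: DV_def i_retraction D(4) split_linear_simps)
  have D_s: "D (s x) = s (DG x) + i (\<phi> x)" for x
    unfolding DG_def \<phi>_def by (rule split)
  note lin = linear_laws[OF D(1)] linear_laws[OF linear_retraction] split_linear_simps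
  have "inv i (D (i v)) = DV v" for v
    using inj_i by (simp add: D_i)
  then have eta: "eta i p s D = (DV, DG)"
    by (simp add: eta_def DG_def fun_eq_iff)
  have linear: "Vector_Spaces.linear sV sV DV" "Vector_Spaces.linear sG sG DG"
    "Vector_Spaces.linear sG sV \<phi>"
    by (auto intro!: linearI simp: DV_def DG_def \<phi>_def lin vector_space_sV vector_space_sG)
  note lin' = linear_laws[OF linear(1)] linear_laws[OF linear(2)] linear_laws[OF linear(3)]
  have "D e = lift \<phi> DV DG e" for e
  proof -
    have "D e = D (s (p e) + i (retraction e))" by (simp flip: split)
    then show ?thesis by (simp add: lin D_i D_s lift_def)
  qed
  then have lift: "D = lift \<phi> DV DG" by auto
  have "DG (brG x y) = brG (DG x) y + brG x (DG y)" for x y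
    using arg_cong[OF D(2)[of "s x" "s y"], of p] by (simp add: expand lin D_s D_i)
  moreover have "N (DG x) = DG (N x)" for x
    using arg_cong[OF D(3)[of "s x"], of p] by (simp add: expand lin D_s D_i)
  moreover have "S (DV v) = DV (S v)" for v
    using D(3)[of "i v"] by (simp add: D_i U_i)
  moreover have "DV (\<rho> x v) = \<rho> (DG x) v + \<rho> x (DV v)" for x v
    using arg_cong[OF D(2)[of "s x" "i v"], of retraction] by (simp add: expand lin D_s D_i)
  ultimately have pair: "(DV, DG) \<in> compatible_der sG brG N sV \<rho> S"
    by (simp add: compatible_der_iff linear)
  show ?thesis
  proof (rule that[OF eta pair linear(3) lift])
    show "DV (\<chi> x y) - \<chi> (DG x) y - \<chi> x (DG y) = \<rho> x (\<phi> y) - \<rho> y (\<phi> x) - \<phi> (brG x y)" for x y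
      using arg_cong[OF D(2)[of "s x" "s y"], of retraction] by (simp add: expand lin D_s D_i algebra_simps)
    show "DV (F x) - F (DG x) = S (\<phi> x) - \<phi> (N x)" for x
      using arg_cong[OF D(3)[of "s x"], of retraction] by (simp add: expand lin D_s D_i algebra_simps)
  qed
qed

section \<open>Exactness\<close>

text \<open>
  \<open>\<iota>\<close> corresponds to the strictly triangular matrices. With the pair \<open>(0, 0)\<close> the twisted cochain is
  zero, so the lifting criterion becomes the definition of a derivation with values in \<open>V\<close>.
\<close>

lemma iota_eq_lift: "iota i p d = lift d (\<lambda>v. 0) (\<lambda>x. 0)"
  by (simp add: iota_def lift_def fun_eq_iff split_linear_simps)

lemma zero_pair_compatible: "(\<lambda>v. 0, \<lambda>x. 0) \<in> compatible_der sG brG N sV \<rho> S"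
  by (simp add: compatible_der_iff linearI vector_space_sG vector_space_sV linear_simps)

lemma linear_map_iota: "linear_map coeff_ders ext_ders (iota i p)"
proof -
  have "iota i p d \<in> der_preserving sE brE U i" if "d \<in> der_coeff sG brG N sV \<rho> S" for d
    unfolding iota_eq_lift using that
    by (intro lift_in_der_preserving zero_pair_compatible)
      (auto simp: der_coeff_def fun_eq_iff cocycle_simps)
  then show ?thesis
    using is_vspace_coeff_ders is_vspace_ext_ders
    by (auto simp: linear_map_def subspace_of_def iota_def fun_scale_def fun_eq_iff split_linear_simps)
qed

lemma vker_iota: "vker coeff_ders ext_ders (iota i p) = {zer coeff_ders}"
proof -
  have "d = 0" if "iota i p d = 0" for d
  proof
    fix x
    have "i (d (p (s x))) = 0" using that by (metis iota_def zero_fun_apply)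
    then have "i (d x) = i 0" by (simp add: split_linear_simps)
    then show "d x = 0 x" by simp
  qed
  moreover have "iota i p 0 = 0"
    by (simp add: iota_def fun_eq_iff split_linear_simps)
  moreover have "0 \<in> der_coeff sG brG N sV \<rho> S"
    using is_vspace_coeff_ders by (simp add: is_vspace_def subspace_of_def)
  ultimately show ?thesis
    by (auto simp: vker_def subspace_of_def)
qed

lemma linear_map_eta: "linear_map ext_ders pair_ders (eta i p s)"
proof -
  have "eta i p s D \<in> compatible_der sG brG N sV \<rho> S" if "D \<in> der_preserving sE brE U i" for D
    using eq_lift_of_eta[OF that] by metis
  \<comment> \<open>The definition of \<open>\<eta>\<close> contains \<open>inv i\<close>, which need not be linear off \<open>range i\<close>; on derivations that
    preserve \<open>V\<close> it may be replaced by the retraction, which is linear on all of \<open>\<ee>\<close>.\<close>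
  moreover have "eta i p s D = (\<lambda>v. retraction (D (i v)), \<lambda>x. p (D (s x)))"
    if "D \<in> der_preserving sE brE U i" for D
    using that by (auto simp: der_preserving_iff eta_def retraction_def split_linear_simps fun_eq_iff)
  moreover have "D + D' \<in> der_preserving sE brE U i" "fun_scale sE c D \<in> der_preserving sE brE U i"
    if "D \<in> der_preserving sE brE U i" "D' \<in> der_preserving sE brE U i" for D D' c
    using is_vspace_ext_ders that by (auto simp: is_vspace_def subspace_of_def)
  ultimately show ?thesis
    using is_vspace_ext_ders is_vspace_pair_ders
    by (auto simp: linear_map_def subspace_of_def fun_eq_iff prod_scale_def fun_scale_def
        linear_laws[OF linear_retraction] split_linear_simps)
qed

lemma vker_eta: "vker ext_ders pair_ders (eta i p s) = iota i p ` carr coeff_ders"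
proof (intro set_eqI iffI)
  fix D assume "D \<in> vker ext_ders pair_ders (eta i p s)"
  then have D: "D \<in> der_preserving sE brE U i" and zero: "eta i p s D = (0, 0)"
    by (simp_all add: vker_def subspace_of_def zero_prod_def)
  obtain DV DG \<phi> where eta: "eta i p s D = (DV, DG)"
    and \<phi>: "Vector_Spaces.linear sG sV \<phi>" "D = lift \<phi> DV DG"
    "\<And>x y. DV (\<chi> x y) - \<chi> (DG x) y - \<chi> x (DG y) = \<rho> x (\<phi> y) - \<rho> y (\<phi> x) - \<phi> (brG x y)"
    "\<And>x. DV (F x) - F (DG x) = S (\<phi> x) - \<phi> (N x)"
    using eq_lift_of_eta[OF D] by metis
  have "DV = (\<lambda>v. 0)" "DG = (\<lambda>x. 0)" using eta zero by (auto simp: zero_fun_def)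
  with \<phi> have "\<phi> \<in> der_coeff sG brG N sV \<rho> S" "D = iota i p \<phi>"
    by (simp_all add: der_coeff_iff iota_eq_lift cocycle_simps)
  then show "D \<in> iota i p ` carr coeff_ders" by (simp add: subspace_of_def)
next
  fix D assume "D \<in> iota i p ` carr coeff_ders"
  then obtain d where d: "d \<in> carr coeff_ders" "D = iota i p d" by auto
  then have "D \<in> carr ext_ders" using linear_map_iota by (simp add: linear_map_def)
  moreover have "Vector_Spaces.linear sG sV d" using d(1) by (simp add: subspace_of_def der_coeff_def)
  then have "eta i p s D = (\<lambda>v. 0, \<lambda>x. 0)"
    unfolding d(2) iota_eq_lift
    by (intro eta_lift) (auto intro!: linearI vector_space_sV vector_space_sG)
  ultimately show "D \<in> vker ext_ders pair_ders (eta i p s)"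
    by (simp add: vker_def subspace_of_def zero_prod_def zero_fun_def)
qed

text \<open>
  A linear map with the twisted cochain as coboundary is precisely what is missing to lift the
  pair to \<open>\<ee>\<close>.
\<close>

lemma twisted_pair_coboundary_iff:
  assumes "a \<in> compatible_der sG brG N sV \<rho> S"
  shows "twisted_pair (\<chi>, F) a \<in> coboundaries sG brG N sV \<rho> S
    \<longleftrightarrow> a \<in> eta i p s ` der_preserving sE brE U i"
proof
  obtain DV DG where a: "a = (DV, DG)" by fastforce
  then have lin: "Vector_Spaces.linear sV sV DV" "Vector_Spaces.linear sG sG DG"
    using assms by (simp_all add: compatible_der_iff)
  assume "twisted_pair (\<chi>, F) a \<in> coboundaries sG brG N sV \<rho> S"
  then obtain \<phi> where "Vector_Spaces.linear sG sV \<phi>"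
    "\<And>x y. DV (\<chi> x y) - \<chi> (DG x) y - \<chi> x (DG y) = \<rho> x (\<phi> y) - \<rho> y (\<phi> x) - \<phi> (brG x y)"
    "\<And>x. DV (F x) - F (DG x) = S (\<phi> x) - \<phi> (N x)"
    by (auto simp: a twisted_pair_def coboundaries_def)
  then have "lift \<phi> DV DG \<in> der_preserving sE brE U i" "eta i p s (lift \<phi> DV DG) = a"
    using assms lin by (simp_all add: a lift_in_der_preserving eta_lift)
  then show "a \<in> eta i p s ` der_preserving sE brE U i" by force
next
  assume "a \<in> eta i p s ` der_preserving sE brE U i"
  then obtain D where D: "D \<in> der_preserving sE brE U i" "a = eta i p s D" by auto
  show "twisted_pair (\<chi>, F) a \<in> coboundaries sG brG N sV \<rho> S"
    by (rule eq_lift_of_eta[OF D(1)]) (auto simp: D(2) twisted_pair_def coboundaries_def)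
qed

lemma wells_exact_sequence:
  "exact_sequence coeff_ders ext_ders pair_ders (H2 sG brG N sV \<rho> S)
     (iota i p) (eta i p s) (wells sG brG N sV \<rho> S brE U i s)"
proof -
  interpret H: subquotient "cochain_scale sV :: 'k \<Rightarrow> ('g \<Rightarrow> 'g \<Rightarrow> 'v) \<times> ('g \<Rightarrow> 'v) \<Rightarrow> _"
    "cocycles sG brG N sV \<rho> S" "coboundaries sG brG N sV \<rho> S"
    by (intro subquotient.intro subquotient_axioms.intro vector_space_cochains
        subspace_cocycles subspace_coboundaries)
  have wells: "wells sG brG N sV \<rho> S brE U i s = (\<lambda>a. H.coset (twisted_pair (\<chi>, F) a))"
    by (simp add: wells_def fun_eq_iff cohomologous_eq_coset_rel)
  note twist = linear_map_twisted_pair[OF chi_F_cocycle]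
  have "linear_map pair_ders (H2 sG brG N sV \<rho> S) (wells sG brG N sV \<rho> S brE U i s)"
    unfolding wells H2_eq_quotient by (rule H.linear_map_coset[OF twist])
  moreover have "eta i p s ` carr ext_ders \<subseteq> carr pair_ders"
    using linear_map_eta by (auto simp: linear_map_def)
  then have "vker pair_ders (H2 sG brG N sV \<rho> S) (wells sG brG N sV \<rho> S brE U i s)
      = eta i p s ` carr ext_ders"
    unfolding wells H2_eq_quotient H.vker_coset[OF twist]
    using twisted_pair_coboundary_iff by (auto simp: subspace_of_def)
  ultimately show ?thesis
    by (simp add: exact_sequence_def linear_map_iota linear_map_eta vker_iota vker_eta)
qed

end

text \<open>
  Over a field every surjective linear map splits.
\<close>

lemma (in abelian_extension) linear_section_exists: "\<exists>s. linear_section sG sE p s"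
proof -
  interpret E_G: vector_space_pair sE sG
    using hom_p by (intro vector_space_pair.intro)
      (auto simp: nijenhuis_hom_def linear_domain linear_codomain)
  show ?thesis
    using E_G.linear_surjective_right_inverse[of p] hom_p surj_p
    by (auto simp: nijenhuis_hom_def linear_section_def)
qed

theorem theorem5p5:
  fixes sG :: "'k::field \<Rightarrow> 'g::ab_group_add \<Rightarrow> 'g" and brG :: "'g \<Rightarrow> 'g \<Rightarrow> 'g" and N :: "'g \<Rightarrow> 'g"
    and sV :: "'k \<Rightarrow> 'v::ab_group_add \<Rightarrow> 'v" and \<rho> :: "'g \<Rightarrow> 'v \<Rightarrow> 'v" and S :: "'v \<Rightarrow> 'v"
    and sE :: "'k \<Rightarrow> 'e::ab_group_add \<Rightarrow> 'e" and brE :: "'e \<Rightarrow> 'e \<Rightarrow> 'e" and U :: "'e \<Rightarrow> 'e"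
    and i :: "'v \<Rightarrow> 'e" and p :: "'e \<Rightarrow> 'g"
  assumes "abelian_extension sG brG N sV \<rho> S sE brE U i p"
  shows "(\<exists>s. linear_section sG sE p s) \<and>
    (\<forall>s. linear_section sG sE p s \<longrightarrow>
      exact_sequence
        (subspace_of (fun_scale sV) (der_coeff sG brG N sV \<rho> S))
        (subspace_of (fun_scale sE) (der_preserving sE brE U i))
        (subspace_of (prod_scale (fun_scale sV) (fun_scale sG)) (compatible_der sG brG N sV \<rho> S))
        (H2 sG brG N sV \<rho> S)
        (iota i p)
        (eta i p s)
        (wells sG brG N sV \<rho> S brE U i s))"
proof -
  interpret abelian_extension sG brG N sV \<rho> S sE brE U i p by fact
  have "split_abelian_extension sG brG N sV \<rho> S sE brE U i p s" if "linear_section sG sE p s" for s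
    using that
    by (intro split_abelian_extension.intro split_abelian_extension_axioms.intro
        abelian_extension_axioms)
  then show ?thesis
    using linear_section_exists split_abelian_extension.wells_exact_sequence by blast
qed

end
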